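(* Let $F\in\mathcal P_d$ form an $(h,0,\eta,m,M)$-regular cluster and let $G=\Psi_{0,h}(F)$ be its model signal. Then: 1. For each $\epsilon>0$, $$\bar E_\epsilon(F)=\Pi_{\epsilon,\frac1h}(G).$$ 2. For each positive $\epsilon\le R\,h^{2d-1}$ and each $q=0,\dots,2d-1$, the set $\bar E_\epsilon(F)$ is contained in the $\Delta_q$-neighborhood of $S_{q,\epsilon,\frac1h}(G)$, where $$\Delta_q=C_4\left(\tfrac1h\right)^q\epsilon .$$ Here $R,C_4>0$ are the constants, depending only on $d,\eta,m,M$, described in the context.
   Context: Let $d\ge2$. $\mathcal P_d$ is the set of $F=(a,x)\in\mathbb R^d\times\mathbb R^d$ with $x_1<\dots<x_d$ and all $a_j\ne0$; $F$ is identified with $F(x)=\sum_j a_j\delta(x-x_j)$. Moments: $m_k(F)=\sum_{j=1}^d a_jx_j^k$. All norms are maximum norms: $\|F\|=\max(\|a\|,\|x\|)$, $\|v\|=\max_j|v_j|$. The (closed) $\Delta$-neighborhood of a set is the set of points at distance at most $\Delta$ from it in the maximum norm. Put $h(F)=\frac12(x_d-x_1)$, $\kappa(F)=\frac12(x_1+x_d)$. For $0<m\le M$ and $\eta>0$, $F$ forms an $(h,\kappa,\eta,m,M)$-regular cluster if $h=h(F)\le\frac12$, $\kappa=\kappa(F)$, $m\le|a_j|\le M$ for all $j$, and $x_{j+1}-x_j\ge\eta h$ for $j=1,\dots,d-1$. The normalization is $\Psi_{\kappa,h}(a,x)=(a,\bar x)$, $\bar x_j=\frac1h(x_j-\kappa)$;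 $\Psi_{\kappa(F),h(F)}(F)$ is the model signal of $F$. Error set: $E_\epsilon(F)=\{F'\in\mathcal P_d: |m_k(F')-m_k(F)|\le\epsilon,\ k=0,\dots,2d-1\}$; normalized error set: $\bar E_\epsilon(F)=\Psi_{\kappa,h}(E_\epsilon(F))$ with $\kappa=\kappa(F)$, $h=h(F)$. For $G\in\mathcal P_d$ and $\epsilon,\alpha>0$: $\Pi_{\epsilon,\alpha}(G)=\{G'\in\mathcal P_d: |m_k(G')-m_k(G)|\le\epsilon\alpha^k,\ k=0,\dots,2d-1\}$. For $0\le q\le 2d-1$, $S_q(G)$ is the set of $(a,x)\in\mathbb R^d\times\mathbb R^d$ with $\sum_j a_jx_j^k=m_k(G)$ for $k=0,\dots,q$, and $S_{q,\epsilon,\alpha}(G)$ is the set of signals $G'\in S_q(G)\cap\mathcal P_d$ with $|m_k(G')-m_k(G)|\le\epsilon\alpha^k$ for $k=q+1,\dots,2d-1$. Constants: let $PM:\mathcal P_d\to\mathbb R^{2d}$, $PM(F)=(m_0(F),\dots,m_{2d-1}(F))$, and $Q_R(\nu)=\{\nu':\|\nu'-\nu\|\le R\}$. A signal in $\mathcal P_d$ is $(\eta,m,M)$-regular if its nodes lie in $[-1,1]$, neighboring nodes are at distance at least $\eta$, and its amplitudes satisfy $m\le|a_j|\le M$. The positive constants $R,C_3,C_4$, depending only on $d,\eta,m,M$, are such that for every $(\eta,m,M)$-regular $G$ with $\nu=PM(G)$, the inverse $PM^{-1}$ exists on $Q_R(\nu)$, is a diffeomorphism of $Q_R(\nu)$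 onto $PM^{-1}(Q_R(\nu))$, and $C_3\|\nu''-\nu'\|\le\|PM^{-1}(\nu'')-PM^{-1}(\nu')\|\le C_4\|\nu''-\nu'\|$ for all $\nu',\nu''\in Q_R(\nu)$ (such constants exist). *)

theory Defs
  imports "HOL-Analysis.Analysis"
begin

text \<open>
  A signal with \<open>d = CARD('d)\<close> nodes is a pair \<open>(a, x)\<close> of vectors in \<open>real ^ 'd\<close>.
  The linear order of the finite index type \<open>'d\<close> plays the role of \<open>1 < 2 < \<dots> < d\<close>.
\<close>

type_synonym 'd signal = "(real ^ 'd) \<times> (real ^ 'd)"

abbreviation amps :: "'d signal \<Rightarrow> real ^ 'd" where "amps \<equiv> fst"
abbreviation nodes :: "'d signal \<Rightarrow> real ^ 'd" where "nodes \<equiv> snd"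

definition signals :: "('d::{finite,linorder}) signal set" where
  "signals = {F. strict_mono (\<lambda>j. nodes F $ j) \<and> (\<forall>j. amps F $ j \<noteq> 0)}"

definition moment :: "nat \<Rightarrow> ('d::finite) signal \<Rightarrow> real" where
  "moment k F = (\<Sum>j\<in>UNIV. amps F $ j * nodes F $ j ^ k)"

text \<open>
  The product type carries the Euclidean norm, whereas all distances here are in the maximum norm;
  on \<open>real ^ 'n\<close> the latter is \<^const>\<open>infnorm\<close>.
\<close>

definition signal_norm :: "('d::finite) signal \<Rightarrow> real" where
  "signal_norm F = max (infnorm (amps F)) (infnorm (nodes F))"

text \<open>
  \<open>nbhd \<Delta> S\<close> consists of the points whose distance to \<open>S\<close> (an infimum) is at most \<open>\<Delta>\<close>;
  no point is near the empty set.
\<close>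

definition nbhd :: "real \<Rightarrow> ('d::finite) signal set \<Rightarrow> 'd signal set" where
  "nbhd \<Delta> S = {F. S \<noteq> {} \<and> (INF G\<in>S. signal_norm (F - G)) \<le> \<Delta>}"

definition half_span :: "('d::{finite,linorder}) signal \<Rightarrow> real" where
  "half_span F = (nodes F $ Max UNIV - nodes F $ Min UNIV) / 2"

definition center :: "('d::{finite,linorder}) signal \<Rightarrow> real" where
  "center F = (nodes F $ Min UNIV + nodes F $ Max UNIV) / 2"

definition neighbors :: "('d::linorder) \<Rightarrow> 'd \<Rightarrow> bool" where
  "neighbors i j \<longleftrightarrow> i < j \<and> (\<nexists>k. i < k \<and> k < j)"

definition regular_cluster ::
    "real \<Rightarrow> real \<Rightarrow> real \<Rightarrow> real \<Rightarrow> real \<Rightarrow> ('d::{finite,linorder}) signal \<Rightarrow> bool" where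
  "regular_cluster h \<kappa> \<eta> m M F \<longleftrightarrow>
     h = half_span F \<and> h \<le> 1 / 2 \<and> \<kappa> = center F \<and>
     (\<forall>j. m \<le> \<bar>amps F $ j\<bar> \<and> \<bar>amps F $ j\<bar> \<le> M) \<and>
     (\<forall>i j. neighbors i j \<longrightarrow> nodes F $ j - nodes F $ i \<ge> \<eta> * h)"

definition Psi :: "real \<Rightarrow> real \<Rightarrow> ('d::finite) signal \<Rightarrow> 'd signal" where
  "Psi \<kappa> h F = (amps F, \<chi> j. (nodes F $ j - \<kappa>) / h)"

definition error_set :: "real \<Rightarrow> ('d::{finite,linorder}) signal \<Rightarrow> 'd signal set" where
  "error_set \<epsilon> F =
     {F' \<in> signals. \<forall>k\<in>{0..2 * CARD('d) - 1}. \<bar>moment k F' - moment k F\<bar> \<le> \<epsilon>}"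

definition normalized_error_set :: "real \<Rightarrow> ('d::{finite,linorder}) signal \<Rightarrow> 'd signal set" where
  "normalized_error_set \<epsilon> F = Psi (center F) (half_span F) ` error_set \<epsilon> F"

definition Pi_set :: "real \<Rightarrow> real \<Rightarrow> ('d::{finite,linorder}) signal \<Rightarrow> 'd signal set" where
  "Pi_set \<epsilon> \<alpha> G =
     {G' \<in> signals. \<forall>k\<in>{0..2 * CARD('d) - 1}. \<bar>moment k G' - moment k G\<bar> \<le> \<epsilon> * \<alpha> ^ k}"

definition Prony_variety :: "nat \<Rightarrow> ('d::finite) signal \<Rightarrow> 'd signal set" where
  "Prony_variety q G = {G'. \<forall>k\<in>{0..q}. moment k G' = moment k G}"

definition Prony_variety_part ::
    "nat \<Rightarrow> real \<Rightarrow> real \<Rightarrow> ('d::{finite,linorder}) signal \<Rightarrow> 'd signal set" where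
  "Prony_variety_part q \<epsilon> \<alpha> G =
     {G' \<in> Prony_variety q G \<inter> signals.
        \<forall>k\<in>{q + 1..2 * CARD('d) - 1}. \<bar>moment k G' - moment k G\<bar> \<le> \<epsilon> * \<alpha> ^ k}"

text \<open>
  \<open>R\<^sup>2\<^sup>d\<close> is \<open>real ^ ('d bit0)\<close>: the type \<open>'d bit0\<close> has \<open>2 * CARD('d)\<close> elements, which
  \<^const>\<open>Rep_bit0\<close> enumerates as the integers \<open>0, \<dots>, 2 * CARD('d) - 1\<close>.
\<close>

definition PM :: "('d::finite) signal \<Rightarrow> real ^ ('d bit0)" where
  "PM F = (\<chi> i. moment (nat (Rep_bit0 i)) F)"

definition PM_inv :: "real ^ (('d::{finite,linorder}) bit0) \<Rightarrow> 'd signal" where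
  "PM_inv = inv_into signals PM"

definition cube :: "real \<Rightarrow> real ^ 'n \<Rightarrow> (real ^ 'n) set" where
  "cube R \<nu> = {\<nu>'. infnorm (\<nu>' - \<nu>) \<le> R}"

text \<open>
  The sets on which this is used are closed, so derivatives are taken within the set.
\<close>

definition C1_on :: "'a::real_normed_vector set \<Rightarrow> ('a \<Rightarrow> 'b::real_normed_vector) \<Rightarrow> bool" where
  "C1_on S f \<longleftrightarrow>
     (\<exists>f' :: 'a \<Rightarrow> 'a \<Rightarrow>\<^sub>L 'b.
        (\<forall>x\<in>S. (f has_derivative blinfun_apply (f' x)) (at x within S)) \<and> continuous_on S f')"

definition diffeomorphism_onto ::
    "'a::real_normed_vector set \<Rightarrow> 'b::real_normed_vector set \<Rightarrow> ('a \<Rightarrow> 'b) \<Rightarrow> bool" where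
  "diffeomorphism_onto S T f \<longleftrightarrow> bij_betw f S T \<and> C1_on S f \<and> C1_on T (inv_into S f)"

definition regular_signal ::
    "real \<Rightarrow> real \<Rightarrow> real \<Rightarrow> ('d::{finite,linorder}) signal \<Rightarrow> bool" where
  "regular_signal \<eta> m M G \<longleftrightarrow>
     G \<in> signals \<and>
     (\<forall>j. nodes G $ j \<in> {-1..1}) \<and>
     (\<forall>i j. neighbors i j \<longrightarrow> nodes G $ j - nodes G $ i \<ge> \<eta>) \<and>
     (\<forall>j. m \<le> \<bar>amps G $ j\<bar> \<and> \<bar>amps G $ j\<bar> \<le> M)"

text \<open>
  The constants of the quantitative inverse function theorem for the Prony map \<^const>\<open>PM\<close> on
  signals with \<open>CARD('d)\<close> nodes. They are uniform over all regular signals \<open>G\<close>, i.e. they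
  depend on \<open>d, \<eta>, m, M\<close> only.
\<close>

definition Prony_constants ::
    "('d::{finite,linorder}) itself \<Rightarrow> real \<Rightarrow> real \<Rightarrow> real \<Rightarrow> real \<Rightarrow> real \<Rightarrow> real \<Rightarrow> bool" where
  "Prony_constants _ \<eta> m M R C3 C4 \<longleftrightarrow>
     R > 0 \<and> C3 > 0 \<and> C4 > 0 \<and>
     (\<forall>G :: 'd signal. regular_signal \<eta> m M G \<longrightarrow>
        (let Q = cube R (PM G) in
           (\<forall>\<nu>\<in>Q. \<exists>!G'. G' \<in> signals \<and> PM G' = \<nu>) \<and>
           diffeomorphism_onto Q {G' \<in> signals. PM G' \<in> Q} PM_inv \<and>
           (\<forall>\<nu>'\<in>Q. \<forall>\<nu>''\<in>Q.
              C3 * infnorm (\<nu>'' - \<nu>') \<le> signal_norm (PM_inv \<nu>'' - PM_inv \<nu>') \<and>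
              signal_norm (PM_inv \<nu>'' - PM_inv \<nu>') \<le> C4 * infnorm (\<nu>'' - \<nu>'))))"

end

theory Submission
  imports Defs
begin

text \<open>
  Rescaling the nodes by \<open>1 / h\<close> divides the \<open>k\<close>-th moment by \<open>h ^ k\<close>, which turns the error set
  into \<open>\<Pi>\<close>. A signal \<open>G'\<close> in \<open>\<Pi>\<close> has its moments in the cube where the Prony map is invertible.
  Replacing the moments of \<open>G'\<close> of order at most \<open>q\<close> by those of \<open>G\<close> stays in this cube, changes
  the moments by at most \<open>(1 / h) ^ q * \<epsilon>\<close>, and the signal with the resulting moments lies on the
  Prony variety; the Lipschitz bound for the inverse Prony map concludes.
\<close>

lemma infnorm_cart_le_iff:
  fixes v :: "real ^ 'n"
  shows "infnorm v \<le> c \<longleftrightarrow> (\<forall>i. \<bar>v $ i\<bar> \<le> c)"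
proof
  assume "infnorm v \<le> c"
  then show "\<forall>i. \<bar>v $ i\<bar> \<le> c"
    using component_le_infnorm_cart order_trans by blast
next
  assume "\<forall>i. \<bar>v $ i\<bar> \<le> c"
  then show "infnorm v \<le> c"
    unfolding infnorm_cart by (intro cSup_least) auto
qed

lemma Rep_bit0_less: "nat (Rep_bit0 (i :: ('d::finite) bit0)) < 2 * CARD('d)"
  using Rep_bit0[of i] by auto

lemma ex_Rep_bit0:
  assumes "k < 2 * CARD('d::finite)"
  shows "\<exists>i :: 'd bit0. nat (Rep_bit0 i) = k"
proof
  show "nat (Rep_bit0 (Abs_bit0 (int k) :: 'd bit0)) = k"
    using assms by (subst Abs_bit0_inverse) auto
qed

lemma PM_nth: "PM F $ i = moment (nat (Rep_bit0 i)) F"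
  by (simp add: PM_def)

lemma mem_cube_PM_iff:
  fixes G :: "('d::finite) signal"
  shows "\<nu> \<in> cube R (PM G) \<longleftrightarrow> (\<forall>i. \<bar>\<nu> $ i - moment (nat (Rep_bit0 i)) G\<bar> \<le> R)"
  by (simp add: cube_def infnorm_cart_le_iff PM_nth)

text \<open>Distances are nonnegative, so the infimum in \<open>nbhd\<close> is over a set bounded
  below and a single witness \<open>G\<close> bounds it.\<close>

lemma nbhdI:
  assumes "G \<in> S" and "signal_norm (F - G) \<le> \<Delta>"
  shows "F \<in> nbhd \<Delta> S"
proof -
  have "bdd_below ((\<lambda>G. signal_norm (F - G)) ` S)"
    by (rule bdd_belowI[of _ 0]) (auto simp: signal_norm_def infnorm_pos_le le_max_iff_disj)
  then have "(INF G\<in>S. signal_norm (F - G)) \<le> \<Delta>"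
    using assms by (blast intro: cINF_lower2)
  then show ?thesis
    using assms(1) by (auto simp: nbhd_def)
qed

lemma half_span_pos:
  fixes F :: "('d::{finite,linorder}) signal"
  assumes "CARD('d) \<ge> 2" and "F \<in> signals"
  shows "half_span F > 0"
proof -
  have "Min (UNIV :: 'd set) \<noteq> Max UNIV"
  proof
    assume eq: "Min (UNIV :: 'd set) = Max UNIV"
    \<comment> \<open>If the least and greatest index coincide, every index is squeezed between them
      and the type has one element.\<close>
    have "j = Max UNIV" for j :: 'd
      using Min_le[of UNIV j] Max_ge[of UNIV j] unfolding eq by (metis UNIV_I finite order.antisym)
    then have "(UNIV :: 'd set) = {Max UNIV}"
      by blast
    then have "CARD('d) = 1"
      by (metis card_1_singleton_iff One_nat_def)
    then show False using assms(1) by simp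
  qed
  then have "Min (UNIV :: 'd set) < Max UNIV"
    by (simp add: order.not_eq_order_implies_strict)
  then show ?thesis
    using assms(2) by (auto simp: signals_def half_span_def dest: strict_monoD)
qed

text \<open>Center 0 matters: a shift of the nodes would mix the \<open>k\<close>-th moment with
  those of lower order.\<close>

lemma moment_Psi: "moment k (Psi 0 h F) = moment k F / h ^ k"
  by (simp add: moment_def Psi_def power_divide sum_divide_distrib)

lemma Psi_in_signals_iff:
  assumes "h > 0"
  shows "Psi \<kappa> h F \<in> signals \<longleftrightarrow> F \<in> signals"
  using assms by (simp add: signals_def Psi_def strict_mono_def divide_less_cancel)

lemma Psi_inverse:
  assumes "h \<noteq> 0"
  shows "Psi 0 h (Psi 0 (1 / h) F) = F"
  using assms by (simp add: Psi_def prod_eq_iff vec_eq_iff)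

lemma Psi_image_error_set:
  fixes F :: "('d::{finite,linorder}) signal"
  assumes "h > 0"
  shows "Psi 0 h ` error_set \<epsilon> F = Pi_set \<epsilon> (1 / h) (Psi 0 h F)"
proof -
  have dev: "\<bar>moment k (Psi 0 h F') - moment k (Psi 0 h F)\<bar> \<le> \<epsilon> * (1 / h) ^ k
      \<longleftrightarrow> \<bar>moment k F' - moment k F\<bar> \<le> \<epsilon>" for k and F' :: "'d signal"
    using assms
    by (simp add: moment_Psi power_divide divide_le_cancel flip: diff_divide_distrib)
  have iff: "Psi 0 h F' \<in> Pi_set \<epsilon> (1 / h) (Psi 0 h F) \<longleftrightarrow> F' \<in> error_set \<epsilon> F" for F'
    using assms by (simp only: Pi_set_def error_set_def mem_Collect_eq dev Psi_in_signals_iff)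
  show ?thesis
  proof
    show "Psi 0 h ` error_set \<epsilon> F \<subseteq> Pi_set \<epsilon> (1 / h) (Psi 0 h F)"
      using iff by blast
    \<comment> \<open>The preimage of a signal in \<Pi> is obtained by scaling its nodes back with
      \<open>Psi 0 (1 / h)\<close>.\<close>
    show "Pi_set \<epsilon> (1 / h) (Psi 0 h F) \<subseteq> Psi 0 h ` error_set \<epsilon> F"
      using iff Psi_inverse[of h] assms by (metis imageI less_irrefl subsetI)
  qed
qed

text \<open>This makes the uniform constants applicable to the model signal: dividing by
  \<open>h\<close> takes nodes in \<open>{-h..h}\<close> to \<open>{-1..1}\<close> and gaps
  \<open>\<eta> * h\<close> to \<open>\<eta>\<close>.\<close>

lemma regular_signal_Psi:
  fixes F :: "('d::{finite,linorder}) signal"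
  assumes "CARD('d) \<ge> 2" and F: "F \<in> signals" and cl: "regular_cluster h 0 \<eta> m M F"
  shows "regular_signal \<eta> m M (Psi 0 h F)"
proof -
  have h: "h > 0"
    using half_span_pos[OF assms(1,2)] cl by (simp add: regular_cluster_def)
  have ends: "nodes F $ Max UNIV = h" "nodes F $ Min UNIV = - h"
    using cl by (auto simp: regular_cluster_def half_span_def center_def)
  have mono: "nodes F $ i \<le> nodes F $ j" if "i \<le> j" for i j
    using F that by (auto simp: signals_def strict_mono_less_eq)
  have "nodes F $ j \<in> {-h..h}" for j
    using mono[of j "Max UNIV"] mono[of "Min UNIV" j] ends by simp
  then show ?thesis
    using h F cl
    by (auto simp: regular_signal_def regular_cluster_def Psi_in_signals_iff)
       (auto simp: Psi_def field_simps)
qed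

text \<open>Used with \<open>\<alpha> = 1 / h\<close>. As \<open>\<alpha> \<ge> 1\<close>, the
  tolerances \<open>\<epsilon> * \<alpha> ^ k\<close> grow with \<open>k\<close>, so bounding the
  one of top order by \<open>R\<close> bounds them all.\<close>

lemma Pi_set_subset_nbhd:
  fixes G :: "('d::{finite,linorder}) signal"
  assumes const: "Prony_constants TYPE('d) \<eta> m M R C3 C4"
    and reg: "regular_signal \<eta> m M G"
    and \<alpha>: "\<alpha> \<ge> 1" and \<epsilon>: "\<epsilon> > 0" and le: "\<epsilon> * \<alpha> ^ (2 * CARD('d) - 1) \<le> R"
    and q: "q < 2 * CARD('d)"
  shows "Pi_set \<epsilon> \<alpha> G \<subseteq> nbhd (C4 * \<alpha> ^ q * \<epsilon>) (Prony_variety_part q \<epsilon> \<alpha> G)"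
proof
  fix G' assume *: "G' \<in> Pi_set \<epsilon> \<alpha> G"
  have G': "G' \<in> signals"
    using * by (simp add: Pi_set_def)
  have dev: "\<bar>moment k G' - moment k G\<bar> \<le> \<epsilon> * \<alpha> ^ k" if "k < 2 * CARD('d)" for k
    using * that by (auto simp: Pi_set_def)
  \<comment> \<open>The mixed moment vector: orders up to \<open>q\<close> come from
    \<open>G\<close>, higher ones from \<open>G'\<close>. The nearby point of the variety will be
    \<open>PM_inv \<nu>\<close>.\<close>
  define \<nu> :: "real ^ 'd bit0" where
    "\<nu> = (\<chi> i. moment (nat (Rep_bit0 i)) (if nat (Rep_bit0 i) \<le> q then G else G'))"
  have R: "R > 0" and C4: "C4 > 0" using const by (auto simp: Prony_constants_def)
  have inv: "\<exists>!G'. G' \<in> signals \<and> PM G' = \<nu>'" if "\<nu>' \<in> cube R (PM G)" for \<nu>'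
    using const reg that unfolding Prony_constants_def Let_def by blast
  have lip: "signal_norm (PM_inv \<nu>'' - PM_inv \<nu>') \<le> C4 * infnorm (\<nu>'' - \<nu>')"
    if "\<nu>' \<in> cube R (PM G)" "\<nu>'' \<in> cube R (PM G)" for \<nu>' \<nu>''
    using const reg that unfolding Prony_constants_def Let_def by blast
  \<comment> \<open>Existence of a signal with moments \<open>\<nu>'\<close> puts
    \<open>\<nu>'\<close> in the image of \<open>PM\<close>, where \<open>inv_into\<close> is a
    right inverse.\<close>
  have PM_inv: "PM_inv \<nu>' \<in> signals" "PM (PM_inv \<nu>') = \<nu>'" if "\<nu>' \<in> cube R (PM G)" for \<nu>'
    using inv[OF that] unfolding PM_inv_def by (auto intro!: inv_into_into f_inv_into_f)
  have devR: "\<bar>moment k G' - moment k G\<bar> \<le> R" if k: "k < 2 * CARD('d)" for k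
  proof -
    have "\<epsilon> * \<alpha> ^ k \<le> \<epsilon> * \<alpha> ^ (2 * CARD('d) - 1)"
      using \<alpha> \<epsilon> k by (intro mult_left_mono power_increasing) auto
    then show ?thesis using dev[OF k] le by linarith
  qed
  have G'_cube: "PM G' \<in> cube R (PM G)"
    unfolding mem_cube_PM_iff PM_nth using devR[OF Rep_bit0_less] by blast
  have \<nu>_cube: "\<nu> \<in> cube R (PM G)"
    unfolding mem_cube_PM_iff
  proof
    fix i :: "'d bit0"
    show "\<bar>\<nu> $ i - moment (nat (Rep_bit0 i)) G\<bar> \<le> R"
      using devR[OF Rep_bit0_less[of i]] R by (cases "nat (Rep_bit0 i) \<le> q") (simp_all add: \<nu>_def)
  qed
  have mom: "moment k (PM_inv \<nu>) = moment k (if k \<le> q then G else G')"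
    if "k < 2 * CARD('d)" for k
    using ex_Rep_bit0[OF that] PM_inv(2)[OF \<nu>_cube]
    by (metis (no_types, lifting) PM_nth \<nu>_def vec_lambda_beta)
  have part: "PM_inv \<nu> \<in> Prony_variety_part q \<epsilon> \<alpha> G"
  proof -
    have "moment k (PM_inv \<nu>) = moment k G" if "k \<le> q" for k
      using mom that q by simp
    moreover have "\<bar>moment k (PM_inv \<nu>) - moment k G\<bar> \<le> \<epsilon> * \<alpha> ^ k"
      if "q < k" "k < 2 * CARD('d)" for k
      using mom dev that by simp
    ultimately show ?thesis
      using PM_inv(1)[OF \<nu>_cube] by (auto simp: Prony_variety_part_def Prony_variety_def)
  qed
  \<comment> \<open>Both sides are signals with moment vector \<open>PM G'\<close>, which lies in
    the cube, so uniqueness there identifies them.\<close>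
  have PM_inv_G': "PM_inv (PM G') = G'"
    using inv[OF G'_cube] PM_inv[OF G'_cube] G' by blast
  \<comment> \<open>Coordinates of order above \<open>q\<close> agree; the others differ by at most
    \<open>\<epsilon> * \<alpha> ^ k\<close> with \<open>k \<le> q\<close>. This is the source of
    the exponent \<open>q\<close> in the radius.\<close>
  have "infnorm (PM G' - \<nu>) \<le> \<epsilon> * \<alpha> ^ q"
    unfolding infnorm_cart_le_iff
  proof
    fix i :: "'d bit0"
    let ?k = "nat (Rep_bit0 i)"
    show "\<bar>(PM G' - \<nu>) $ i\<bar> \<le> \<epsilon> * \<alpha> ^ q"
    proof (cases "?k \<le> q")
      case True
      then have "\<epsilon> * \<alpha> ^ ?k \<le> \<epsilon> * \<alpha> ^ q"
        using \<alpha> \<epsilon> by (intro mult_left_mono power_increasing) auto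
      then show ?thesis
        using dev[OF Rep_bit0_less, of i] True by (simp add: PM_nth \<nu>_def)
    next
      case False
      then show ?thesis using \<alpha> \<epsilon> by (simp add: PM_nth \<nu>_def)
    qed
  qed
  then have "C4 * infnorm (PM G' - \<nu>) \<le> C4 * (\<epsilon> * \<alpha> ^ q)"
    using C4 by simp
  then have "signal_norm (G' - PM_inv \<nu>) \<le> C4 * \<alpha> ^ q * \<epsilon>"
    using lip[OF \<nu>_cube G'_cube] PM_inv_G' by (simp add: mult_ac)
  then show "G' \<in> nbhd (C4 * \<alpha> ^ q * \<epsilon>) (Prony_variety_part q \<epsilon> \<alpha> G)"
    using part by (rule nbhdI[rotated])
qed

theorem theorem5p1:
  fixes F G :: "('d::{finite,linorder}) signal" and h \<eta> m M :: real
  assumes "CARD('d) \<ge> 2"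
    and "0 < m" and "m \<le> M" and "0 < \<eta>"
    and "F \<in> signals"
    and "regular_cluster h 0 \<eta> m M F"
    and "G = Psi 0 h F"
  shows "(\<forall>\<epsilon>>0. normalized_error_set \<epsilon> F = Pi_set \<epsilon> (1 / h) G) \<and>
    (\<forall>R C3 C4. Prony_constants TYPE('d) \<eta> m M R C3 C4 \<longrightarrow>
      (\<forall>\<epsilon>. 0 < \<epsilon> \<and> \<epsilon> \<le> R * h ^ (2 * CARD('d) - 1) \<longrightarrow>
        (\<forall>q\<in>{0..2 * CARD('d) - 1}.
          normalized_error_set \<epsilon> F
            \<subseteq> nbhd (C4 * (1 / h) ^ q * \<epsilon>) (Prony_variety_part q \<epsilon> (1 / h) G))))"
proof -
  have h: "h = half_span F" "center F = 0" "h \<le> 1 / 2"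
    using assms(6) by (auto simp: regular_cluster_def)
  have "h > 0"
    using half_span_pos[OF assms(1,5)] h by simp
  have eq: "normalized_error_set \<epsilon> F = Pi_set \<epsilon> (1 / h) G" for \<epsilon>
    using Psi_image_error_set[OF \<open>h > 0\<close>] h assms(7) by (simp add: normalized_error_set_def)
  have "Pi_set \<epsilon> (1 / h) G \<subseteq> nbhd (C4 * (1 / h) ^ q * \<epsilon>) (Prony_variety_part q \<epsilon> (1 / h) G)"
    if "Prony_constants TYPE('d) \<eta> m M R C3 C4" "0 < \<epsilon>" "\<epsilon> \<le> R * h ^ (2 * CARD('d) - 1)"
      "q \<in> {0..2 * CARD('d) - 1}"
    for R C3 C4 \<epsilon> q
  proof (rule Pi_set_subset_nbhd[OF that(1) _ _ that(2)])
    show "regular_signal \<eta> m M G"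
      using regular_signal_Psi assms by blast
    show "1 / h \<ge> 1"
      using h \<open>h > 0\<close> by simp
    \<comment> \<open>This is the smallness assumption on \<epsilon> divided by
      \<open>h ^ (2 * CARD('d) - 1)\<close>.\<close>
    show "\<epsilon> * (1 / h) ^ (2 * CARD('d) - 1) \<le> R"
      using that(3) \<open>h > 0\<close> by (simp add: power_divide pos_divide_le_eq)
    \<comment> \<open>The subtraction in \<open>2 * CARD('d) - 1\<close> is on naturals; it is exact
      since the cardinality is positive.\<close>
    show "q < 2 * CARD('d)"
      using that(4) assms(1) by auto
  qed
  then show ?thesis unfolding eq by (intro conjI allI impI ballI) auto
qed

end
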